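(* For $1<t<2$ let $Q_t\subset\mathbb C^{28}\times\mathbb C^{28}$ be the CR quadric given, for $Z=(Z_1,\dots,Z_4)\in(\mathcal A_t^{\mathbb C})^4\simeq\mathbb C^{28}$ and $W=(W_1,\dots,W_4)\in(\mathcal A_t^{\mathbb C})^4\simeq\mathbb C^{28}$, by $$\begin{aligned}\mathrm{Im}\,W_1&=Z_1\overline{Z_2}+Z_2\overline{Z_1},\\ \mathrm{Im}\,W_2&=iZ_1\overline{Z_2}-iZ_2\overline{Z_1},\\ \mathrm{Im}\,W_3&=Z_2\overline{Z_2},\\ \mathrm{Im}\,W_4&=Z_1\overline{Z_4}+Z_4\overline{Z_1}+Z_2\overline{Z_3}+Z_3\overline{Z_2},\end{aligned}$$ where $\mathcal A_t$ is the seven-dimensional real algebra defined in the context and $\mathcal A_t^{\mathbb C}=\mathcal A_t\otimes_{\mathbb R}\mathbb C$. Then every $Q_t$, $1<t<2$, is a nondegenerate exceptional CR quadric of type $(28,28)$. If $s,t\in(1,2)$ and $s\neq t$, then $Q_s$ and $Q_t$ lie in distinct orbits of the group $SL(28,\mathbb C)\times GL(28,\mathbb R)$. Consequently, the set of exceptional $(28,28)$-orbits has at least one continuous modulus (it contains the family of pairwise distinct orbits of $Q_t$ parametrized by $t\in(1,2)$).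
   Context: Algebra $\mathcal A_t$: for a real $t$, $\mathcal A_t$ is the real commutative associative unital algebra with basis $1,e_1,e_2,e_3,e_4,p,q$, in which the only nonzero products of basis elements of $\mathfrak m_t=\mathrm{span}\{e_1,e_2,e_3,e_4,p,q\}$ are $$e_1^2=p,\quad e_2^2=p+q,\quad e_3^2=p+tq,\quad e_4^2=q$$ (so $e_ae_b=0$ for $a\ne b$ and $p\,\mathfrak m_t=q\,\mathfrak m_t=0$). The complexification $\mathcal A_t^{\mathbb C}=\mathcal A_t\otimes_{\mathbb R}\mathbb C\simeq\mathbb C^7$ carries the $\mathbb C$-bilinear multiplication, and $\overline{\,\cdot\,}$ and $\mathrm{Im}$ are taken coordinatewise in the basis $1,e_1,\dots,e_4,p,q$ (conjugation fixing $\mathcal A_t$). Each of the four equations of $Q_t$ is an equality in the real algebra $\mathcal A_t$, i.e. seven real equations. A tuple $H=(H_1,\dots,H_k)$ of Hermitian matrices of order $n$ is nondegenerate if the matrices are linearly independent over $\mathbb R$ and have no common kernel. It defines the vector-valued Hermitian form $\langle z,\bar z\rangle=(H_1z\cdot\bar z,\dots,H_kz\cdot\bar z)$ and the CR quadric of type $(n,k)$: $Q=\{(z,w)\in\mathbb C^n\times\mathbb C^k:\mathrm{Im}\,w=\langle z,\bar z\rangle\}$; $Q$ is called nondegenerate if $H$ is. Let $\mathrm{aut}\,Q$ be the real Lie algebra of germs at $0$ of holomorphic vector fields $X=\sum_j f_j\,\partial/\partial z_j+\sum_l h_l\,\partial/\partial w_l$ (with $f_j,h_l$ holomorphic in $(z,w)$)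 such that $2\,\mathrm{Re}\,X$ is tangent to $Q$. Assign weight $1$ to each $z_j$, weight $2$ to each $w_l$, weight $-1$ to $\partial/\partial z_j$, weight $-2$ to $\partial/\partial w_l$. For nondegenerate $Q$, $\mathrm{aut}\,Q$ is a finite-dimensional graded Lie algebra $g_{-2}+g_{-1}+g_0+\dots+g_d$, with $g_j$ the component of weight $j$ and $g_d\ne0$. A nondegenerate quadric $Q$ is exceptional if $d>2$, i.e. $g_j\neq0$ for some $j\ge3$. Group action: $(C,\rho)\in SL(n,\mathbb C)\times GL(k,\mathbb R)$ acts on quadrics of type $(n,k)$ (equivalently on $k$-tuples of Hermitian matrices) by sending the quadric with form $\langle z,\bar z\rangle$ to the quadric with form $\rho^{-1}\langle Cz,\overline{Cz}\rangle$; an exceptional orbit is the orbit of an exceptional quadric. *)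

theory Defs
  imports "HOL-Analysis.Analysis"
begin

section \<open>Hermitian tuples and CR quadrics\<close>

text \<open>A \<open>k\<close>-tuple of \<open>n \<times> n\<close> matrices has type \<open>complex^'n^'n^'k\<close>, where
  \<open>n = CARD('n)\<close> and \<open>k = CARD('k)\<close>.\<close>

definition hermitian_matrix :: "complex^'n^'n \<Rightarrow> bool" where
  "hermitian_matrix A \<longleftrightarrow> (\<forall>a b. A $ a $ b = cnj (A $ b $ a))"

definition hermitian_tuple :: "complex^'n^'n^'k \<Rightarrow> bool" where
  "hermitian_tuple H \<longleftrightarrow> (\<forall>l. hermitian_matrix (H $ l))"

definition nondegenerate_tuple :: "complex^'n^'n^'k \<Rightarrow> bool" where
  "nondegenerate_tuple H \<longleftrightarrow>
     (\<forall>c :: 'k \<Rightarrow> real. (\<Sum>l\<in>UNIV. c l *\<^sub>R H $ l) = 0 \<longrightarrow> (\<forall>l. c l = 0)) \<and>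
     (\<forall>z. (\<forall>l. H $ l *v z = 0) \<longrightarrow> z = 0)"

text \<open>For a Hermitian tuple the sum below is real, so taking its real part only changes its type.\<close>

definition hermitian_form :: "complex^'n^'n^'k \<Rightarrow> complex^'n \<Rightarrow> real^'k" where
  "hermitian_form H z = (\<chi> l. Re (\<Sum>a\<in>UNIV. (H $ l *v z) $ a * cnj (z $ a)))"

type_synonym ('n, 'k) pt = "(complex^'n) \<times> (complex^'k)"

definition quadric_of_form :: "(complex^'n \<Rightarrow> real^'k) \<Rightarrow> ('n, 'k) pt set" where
  "quadric_of_form \<phi> = {(z, w). (\<chi> l. Im (w $ l)) = \<phi> z}"

definition cr_quadric :: "complex^'n^'n^'k \<Rightarrow> ('n, 'k) pt set" where
  "cr_quadric H = quadric_of_form (hermitian_form H)"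

definition cr_quadric_of_type :: "nat \<Rightarrow> nat \<Rightarrow> ('n::finite, 'k::finite) pt set \<Rightarrow> bool" where
  "cr_quadric_of_type n k Q \<longleftrightarrow>
     n = CARD('n) \<and> k = CARD('k) \<and> (\<exists>H. hermitian_tuple H \<and> Q = cr_quadric H)"

definition nondegenerate_quadric :: "('n::finite, 'k::finite) pt set \<Rightarrow> bool" where
  "nondegenerate_quadric Q \<longleftrightarrow>
     (\<exists>H. hermitian_tuple H \<and> Q = cr_quadric H \<and> nondegenerate_tuple H)"


section \<open>Infinitesimal automorphisms\<close>

text \<open>The vector field \<open>\<Sum>\<^sub>j f\<^sub>j \<partial>/\<partial>z\<^sub>j + \<Sum>\<^sub>l h\<^sub>l \<partial>/\<partial>w\<^sub>l\<close> is represented by its coefficient map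
  \<open>(z, w) \<mapsto> (f (z, w), h (z, w))\<close>.\<close>

type_synonym ('n, 'k) vfield = "('n, 'k) pt \<Rightarrow> ('n, 'k) pt"

definition cscale :: "complex \<Rightarrow> ('n::finite, 'k::finite) pt \<Rightarrow> ('n, 'k) pt" where
  "cscale c p = (c *s fst p, c *s snd p)"

text \<open>Holomorphic in several variables: Frechet differentiable with complex-linear derivative.\<close>

definition holomorphic_near_0 :: "('n::finite, 'k::finite) vfield \<Rightarrow> bool" where
  "holomorphic_near_0 X \<longleftrightarrow>
     (\<exists>U. open U \<and> 0 \<in> U \<and>
        (\<forall>p\<in>U. \<exists>D. (X has_derivative D) (at p) \<and> (\<forall>c v. D (cscale c v) = cscale c (D v))))"

definition defining_map :: "complex^'n^'n^'k \<Rightarrow> ('n, 'k) pt \<Rightarrow> real^'k" where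
  "defining_map H p = (\<chi> l. Im (snd p $ l)) - hermitian_form H (fst p)"

text \<open>The operator \<open>\<partial>/\<partial>z\<^sub>j\<close> is \<open>(\<partial>/\<partial>x\<^sub>j - \<i> \<partial>/\<partial>y\<^sub>j) / 2\<close>, so the real vector field \<open>2 Re X\<close> is the
  coefficient map of \<open>X\<close> read as a real vector field. It is tangent to the quadric when
  the real differential of the defining map annihilates it at the points of the quadric.\<close>

definition tangent_near_0 :: "complex^'n^'n^'k \<Rightarrow> ('n::finite, 'k::finite) vfield \<Rightarrow> bool" where
  "tangent_near_0 H X \<longleftrightarrow>
     (\<forall>\<^sub>F p in nhds 0. p \<in> cr_quadric H \<longrightarrow>
        (\<exists>D. (defining_map H has_derivative D) (at p) \<and> D (X p) = 0))"

definition germ_0 :: "('n::finite, 'k::finite) vfield \<Rightarrow> ('n, 'k) vfield set" where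
  "germ_0 X = {Y. \<forall>\<^sub>F p in nhds 0. Y p = X p}"

definition aut :: "complex^'n^'n^'k \<Rightarrow> ('n::finite, 'k::finite) vfield set set" where
  "aut H = {germ_0 X | X. holomorphic_near_0 X \<and> tangent_near_0 H X}"

text \<open>Multi-indices are pairs \<open>(\<alpha>, \<beta>)\<close>, with \<open>\<alpha>\<close> the exponents of \<open>z\<close> and \<open>\<beta>\<close> those of \<open>w\<close>.\<close>

definition monomial_weight :: "('n::finite \<Rightarrow> nat) \<times> ('k::finite \<Rightarrow> nat) \<Rightarrow> int" where
  "monomial_weight = (\<lambda>(\<alpha>, \<beta>). int ((\<Sum>j\<in>UNIV. \<alpha> j) + 2 * (\<Sum>l\<in>UNIV. \<beta> l)))"

definition monomial_value ::
  "('n \<Rightarrow> nat) \<times> ('k \<Rightarrow> nat) \<Rightarrow> ('n::finite, 'k::finite) pt \<Rightarrow> complex" where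
  "monomial_value = (\<lambda>(\<alpha>, \<beta>) (z, w). (\<Prod>j\<in>UNIV. z $ j ^ \<alpha> j) * (\<Prod>l\<in>UNIV. w $ l ^ \<beta> l))"

definition weighted_homogeneous :: "int \<Rightarrow> (('n::finite, 'k::finite) pt \<Rightarrow> complex) \<Rightarrow> bool" where
  "weighted_homogeneous m F \<longleftrightarrow>
     (\<exists>M c. finite M \<and> (\<forall>\<mu>\<in>M. monomial_weight \<mu> = m) \<and>
        F = (\<lambda>p. \<Sum>\<mu>\<in>M. c \<mu> * monomial_value \<mu> p))"

text \<open>The shifts by \<open>1\<close> and \<open>2\<close> account for the weights \<open>-1\<close> of \<open>\<partial>/\<partial>z\<^sub>j\<close> and \<open>-2\<close> of \<open>\<partial>/\<partial>w\<^sub>l\<close>.\<close>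

definition has_weight :: "int \<Rightarrow> ('n::finite, 'k::finite) vfield \<Rightarrow> bool" where
  "has_weight m X \<longleftrightarrow>
     (\<forall>j. weighted_homogeneous (m + 1) (\<lambda>p. fst (X p) $ j)) \<and>
     (\<forall>l. weighted_homogeneous (m + 2) (\<lambda>p. snd (X p) $ l))"

definition aut_component :: "complex^'n^'n^'k \<Rightarrow> int \<Rightarrow> ('n::finite, 'k::finite) vfield set set" where
  "aut_component H m = aut H \<inter> germ_0 ` {X. has_weight m X}"

definition exceptional_quadric :: "('n::finite, 'k::finite) pt set \<Rightarrow> bool" where
  "exceptional_quadric Q \<longleftrightarrow>
     (\<exists>H. hermitian_tuple H \<and> Q = cr_quadric H \<and> nondegenerate_tuple H \<and>
        (\<exists>m\<ge>3. aut_component H m \<noteq> {germ_0 (\<lambda>_. 0)}))"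


section \<open>Orbits of \<open>SL(n, \<complex>) \<times> GL(k, \<real>)\<close>\<close>

definition transform_form ::
  "complex^'n^'n \<Rightarrow> real^'k^'k \<Rightarrow> (complex^'n \<Rightarrow> real^'k) \<Rightarrow> (complex^'n \<Rightarrow> real^'k)" where
  "transform_form C \<rho> \<phi> = (\<lambda>z. matrix_inv \<rho> *v \<phi> (C *v z))"

definition quadric_orbit :: "('n::finite, 'k::finite) pt set \<Rightarrow> ('n, 'k) pt set set" where
  "quadric_orbit Q =
     {quadric_of_form (transform_form C \<rho> (hermitian_form H)) | C \<rho> H.
        det C = 1 \<and> invertible \<rho> \<and> hermitian_tuple H \<and> Q = cr_quadric H}"

definition exceptional_orbits :: "('n::finite, 'k::finite) pt set set set" where
  "exceptional_orbits = {quadric_orbit Q | Q. exceptional_quadric Q}"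

text \<open>A continuous modulus of a set of orbits is a family of pairwise distinct orbits in it,
  parametrized by an open interval, whose representing Hermitian tuples depend continuously on
  the parameter.\<close>

definition continuous_modulus ::
  "('n::finite, 'k::finite) pt set set set \<Rightarrow> real set \<Rightarrow> (real \<Rightarrow> ('n, 'k) pt set) \<Rightarrow> bool" where
  "continuous_modulus \<O> I Q \<longleftrightarrow>
     (\<exists>a b. a < b \<and> I = {a<..<b}) \<and>
     (\<exists>H. continuous_on I H \<and> (\<forall>t\<in>I. hermitian_tuple (H t) \<and> Q t = cr_quadric (H t))) \<and>
     (\<forall>t\<in>I. quadric_orbit (Q t) \<in> \<O>) \<and>
     inj_on (\<lambda>t. quadric_orbit (Q t)) I"


section \<open>The algebras \<open>A\<^sub>t\<close> and the quadrics \<open>Q\<^sub>t\<close>\<close>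

text \<open>The basis elements \<open>1, e\<^sub>1, e\<^sub>2, e\<^sub>3, e\<^sub>4, p, q\<close>, in this order.\<close>

datatype bas = B1 | E1 | E2 | E3 | E4 | Bp | Bq

lemma UNIV_bas: "UNIV = {B1, E1, E2, E3, E4, Bp, Bq}"
  by (auto intro: bas.exhaust)

instance bas :: finite
  by standard (simp add: UNIV_bas)

lemma CARD_bas: "CARD(bas) = 7"
  by (simp add: UNIV_bas)

fun bas_prod :: "real \<Rightarrow> bas \<Rightarrow> bas \<Rightarrow> real^bas" where
  "bas_prod t B1 b = axis b 1"
| "bas_prod t a B1 = axis a 1"
| "bas_prod t E1 E1 = axis Bp 1"
| "bas_prod t E2 E2 = axis Bp 1 + axis Bq 1"
| "bas_prod t E3 E3 = axis Bp 1 + t *\<^sub>R axis Bq 1"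
| "bas_prod t E4 E4 = axis Bq 1"
| "bas_prod t _ _ = 0"

text \<open>At \<open>'a = real\<close> this is the multiplication of \<open>A\<^sub>t\<close>, at \<open>'a = complex\<close> its
  complex-bilinear extension to the complexification.\<close>

definition alg_mult :: "real \<Rightarrow> 'a::real_algebra_1^bas \<Rightarrow> 'a^bas \<Rightarrow> 'a^bas" where
  "alg_mult t x y = (\<chi> c. \<Sum>a\<in>UNIV. \<Sum>b\<in>UNIV. of_real (bas_prod t a b $ c) * x $ a * y $ b)"

definition alg_cnj :: "complex^bas \<Rightarrow> complex^bas" where
  "alg_cnj x = (\<chi> c. cnj (x $ c))"

text \<open>The imaginary part, as an element of \<open>A\<^sub>t\<close> embedded in the complexification.\<close>

definition alg_Im :: "complex^bas \<Rightarrow> complex^bas" where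
  "alg_Im x = (\<chi> c. of_real (Im (x $ c)))"

text \<open>Vectors with four components in the complexified algebra are indexed by \<open>4 \<times> bas\<close>;
  the numeral type \<open>4\<close> consists of the classes of \<open>1, 2, 3, 4\<close>.\<close>

definition alg_comp :: "complex^(4 \<times> bas) \<Rightarrow> 4 \<Rightarrow> complex^bas" where
  "alg_comp Z j = (\<chi> c. Z $ (j, c))"

definition Qt :: "real \<Rightarrow> (4 \<times> bas, 4 \<times> bas) pt set" where
  "Qt t = {(Z, W).
     let mul = alg_mult t; Z1 = alg_comp Z 1; Z2 = alg_comp Z 2; Z3 = alg_comp Z 3; Z4 = alg_comp Z 4 in
       alg_Im (alg_comp W 1) = mul Z1 (alg_cnj Z2) + mul Z2 (alg_cnj Z1) \<and>
       alg_Im (alg_comp W 2) = \<i> *s mul Z1 (alg_cnj Z2) - \<i> *s mul Z2 (alg_cnj Z1) \<and>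
       alg_Im (alg_comp W 3) = mul Z2 (alg_cnj Z2) \<and>
       alg_Im (alg_comp W 4) = mul Z1 (alg_cnj Z4) + mul Z4 (alg_cnj Z1)
                         + mul Z2 (alg_cnj Z3) + mul Z3 (alg_cnj Z2)}"

end

theory Submission
  imports Defs
begin

text \<open>Exceptionality: since \<open>p m = 0\<close> in \<open>A\<^sub>t\<close>, a vector field whose coefficients are multiples of \<open>p\<close> and depend
  only on the components \<open>z\<^sub>i, w\<^sub>l\<close> along \<open>1\<close> is tangent to \<open>Q\<^sub>t\<close> as soon as the scalar field is tangent
  to the scalar quadric with the same four equations. There \<open>f\<^sub>3 = -i (w\<^sub>1 + i w\<^sub>2) G\<close> and
  \<open>f\<^sub>4 = 2 i w\<^sub>3 G\<close> with \<open>G = 2 z\<^sub>1 w\<^sub>3 - z\<^sub>2 (w\<^sub>1 - i w\<^sub>2)\<close> give a field of weight \<open>4\<close>.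

  Distinctness: an equivalence maps the real span of the Hermitian matrices of one quadric linearly
  onto that of the other and preserves kernel dimensions. In this span, the matrices with kernel of
  dimension greater than \<open>4\<close> form the union of four hyperplanes of one pencil, namely
  \<open>\<lambda> \<mu> (\<lambda> + \<mu>) (\<lambda> + t \<mu>) = 0\<close>, where \<open>\<lambda>\<close> and \<open>\<mu>\<close> are the coefficients of the matrices belonging to
  the \<open>p\<close>- and \<open>q\<close>-components of the fourth equation. The unordered cross ratio of the four hyperplanes
  determines \<open>t\<close> in the interval from \<open>1\<close> to \<open>2\<close>.\<close>

section \<open>Sums over the index types and basic rules of the algebra\<close>

lemma sum_UNIV_prod: "(\<Sum>x\<in>UNIV. f x) = (\<Sum>i\<in>UNIV. \<Sum>b\<in>UNIV. f (i, b))"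
  for f :: "'a::finite \<times> 'b::finite \<Rightarrow> 'c::comm_monoid_add"
  by (simp add: sum.cartesian_product)

lemma sum_bas: "(\<Sum>a\<in>UNIV. f a) = f B1 + f E1 + f E2 + f E3 + f E4 + f Bp + f Bq"
  for f :: "bas \<Rightarrow> 'c::comm_monoid_add"
  by (simp add: UNIV_bas add.assoc)

lemma bas_prod_commute: "bas_prod t a b = bas_prod t b a"
  by (cases a; cases b) simp_all

lemma alg_mult_commute: "alg_mult t x y = alg_mult t y x" for x y :: "complex^bas"
proof -
  have "(\<Sum>a\<in>UNIV. \<Sum>b\<in>UNIV. of_real (bas_prod t a b $ c) * x $ a * y $ b) =
      (\<Sum>b\<in>UNIV. \<Sum>a\<in>UNIV. of_real (bas_prod t b a $ c) * y $ b * x $ a)" for c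
    by (subst sum.swap) (intro sum.cong refl, subst bas_prod_commute, simp)
  then show ?thesis
    by (simp add: alg_mult_def vec_eq_iff)
qed

lemma alg_cnj_simps [simp]: "alg_cnj (alg_cnj x) = x" "alg_cnj x $ c = cnj (x $ c)"
  by (simp_all add: alg_cnj_def vec_eq_iff)

lemma alg_cnj_mult: "alg_cnj (alg_mult t x y) = alg_mult t (alg_cnj x) (alg_cnj y)"
  by (simp add: alg_cnj_def alg_mult_def vec_eq_iff)

lemma cnj_alg_mult_nth: "cnj (alg_mult t x y $ c) = alg_mult t (alg_cnj x) (alg_cnj y) $ c"
  by (metis alg_cnj_mult alg_cnj_simps(2))

section \<open>The Hermitian tuple of the quadric\<close>

text \<open>\<open>base_coeff l i j\<close> is the coefficient of \<open>Z\<^sub>j\<close> times the conjugate of \<open>Z\<^sub>i\<close> in the \<open>l\<close>-th equation.\<close>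

definition base_coeff :: "4 \<Rightarrow> 4 \<Rightarrow> 4 \<Rightarrow> complex" where
  "base_coeff l i j =
     (if l = 1 then (if (i, j) \<in> {(1, 2), (2, 1)} then 1 else 0)
      else if l = 2 then (if (i, j) = (2, 1) then \<i> else if (i, j) = (1, 2) then - \<i> else 0)
      else if l = 3 then (if (i, j) = (2, 2) then 1 else 0)
      else (if (i, j) \<in> {(1, 4), (4, 1), (2, 3), (3, 2)} then 1 else 0))"

text \<open>Block matrices: the scalar matrix of equation \<open>l\<close> tensored with the Gram
  matrix of the symmetric bilinear form that reads off one coordinate of the product in the
  algebra.\<close>

definition Qt_tuple :: "real \<Rightarrow> complex^(4 \<times> bas)^(4 \<times> bas)^(4 \<times> bas)" where
  "Qt_tuple t = (\<chi> l i j. base_coeff (fst l) (fst i) (fst j) *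
     of_real (bas_prod t (snd j) (snd i) $ snd l))"

lemma base_coeff_cnj: "cnj (base_coeff l i j) = base_coeff l j i"
  using exhaust_4[of i] exhaust_4[of j]
  by (elim disjE) (simp_all add: base_coeff_def)

lemma hermitian_Qt_tuple: "hermitian_tuple (Qt_tuple t)"
  unfolding hermitian_tuple_def hermitian_matrix_def Qt_tuple_def
  by (simp add: base_coeff_cnj bas_prod_commute)

lemma Qt_tuple_mult_vec:
  "(Qt_tuple t $ (l, c) *v z) $ (i, a) =
     (\<Sum>j\<in>UNIV. base_coeff l i j * (\<Sum>b\<in>UNIV. of_real (bas_prod t b a $ c) * z $ (j, b)))"
  by (simp only: matrix_vector_mult_def sum_UNIV_prod Qt_tuple_def vec_lambda_beta fst_conv snd_conv
      sum_distrib_left mult.assoc)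

lemma Qt_tuple_form:
  "(\<Sum>x\<in>UNIV. (Qt_tuple t $ (l, c) *v z) $ x * cnj (z $ x)) =
     (\<Sum>i\<in>UNIV. \<Sum>j\<in>UNIV. base_coeff l i j *
        alg_mult t (alg_comp z j) (alg_cnj (alg_comp z i)) $ c)"
proof -
  have "(\<Sum>a\<in>UNIV. (Qt_tuple t $ (l, c) *v z) $ (i, a) * cnj (z $ (i, a))) =
     (\<Sum>j\<in>UNIV. base_coeff l i j * alg_mult t (alg_comp z j) (alg_cnj (alg_comp z i)) $ c)" for i
    unfolding Qt_tuple_mult_vec
    apply (simp add: sum_distrib_right)
    apply (subst sum.swap)
    apply (rule sum.cong[OF refl])
    apply (simp add: alg_mult_def sum_distrib_right sum_distrib_left alg_comp_def)
    apply (subst sum.swap)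
    apply (simp add: mult_ac)
    done
  then show ?thesis
    by (simp add: sum_UNIV_prod)
qed

lemma Qt_eq_cr_quadric: "Qt t = cr_quadric (Qt_tuple t)"
proof -
  have "p \<in> Qt t \<longleftrightarrow> p \<in> cr_quadric (Qt_tuple t)" for p
  proof -
    obtain Z W where p: "p = (Z, W)" by force
    define R where "R l c = (\<Sum>i\<in>UNIV. \<Sum>j\<in>UNIV. base_coeff l i j *
        alg_mult t (alg_comp Z j) (alg_cnj (alg_comp Z i)) $ c)" for l c
    \<comment> \<open>\<open>hermitian_form\<close> keeps only a real part, while \<open>Qt\<close>
      equates complex values. They agree because conjugation swaps \<open>i\<close> and
      \<open>j\<close>, \<open>base_coeff\<close> is Hermitian and the product is
      commutative.\<close>
    have im: "Im (R l c) = 0" for l c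
    proof -
      have "cnj (R l c) = R l c"
        unfolding R_def cnj_sum complex_cnj_mult base_coeff_cnj cnj_alg_mult_nth alg_cnj_simps
        by (subst sum.swap) (simp add: alg_mult_commute)
      then show ?thesis by (simp add: complex_eq_iff)
    qed
    have "p \<in> cr_quadric (Qt_tuple t) \<longleftrightarrow> (\<forall>l c. Im (W $ (l, c)) = Re (R l c))"
      by (simp add: p cr_quadric_def quadric_of_form_def hermitian_form_def vec_eq_iff
          Qt_tuple_form R_def del: Re_sum times_complex.sel)
    also have "\<dots> \<longleftrightarrow> (\<forall>l c. of_real (Im (W $ (l, c))) = R l c)"
      using im by (simp add: complex_eq_iff)
    also have "\<dots> \<longleftrightarrow> p \<in> Qt t"
    proof -
      let ?m = "\<lambda>i j. alg_mult t (alg_comp Z i) (alg_cnj (alg_comp Z j))"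
      have "R 1 c = (?m 1 2 + ?m 2 1) $ c" "R 2 c = (\<i> *s ?m 1 2 - \<i> *s ?m 2 1) $ c"
        "R 3 c = ?m 2 2 $ c" "R 4 c = (?m 1 4 + ?m 4 1 + ?m 2 3 + ?m 3 2) $ c" for c
        by (simp_all add: R_def sum_4 base_coeff_def)
      then show ?thesis
        unfolding p Qt_def Let_def mem_Collect_eq prod.case
        by (simp only: forall_4 vec_eq_iff[of "alg_Im _"])
           (simp add: alg_Im_def alg_comp_def[of W])
    qed
    finally show ?thesis ..
  qed
  then show ?thesis by blast
qed

lemma continuous_bas_prod: "continuous_on S (\<lambda>t. bas_prod t a b)"
  by (cases a; cases b) (auto intro!: continuous_intros)

lemma continuous_Qt_tuple: "continuous_on S Qt_tuple"
  unfolding Qt_tuple_def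
  by (intro continuous_on_vec_lambda continuous_on_mult continuous_on_const continuous_on_of_real
      continuous_on_component continuous_bas_prod)

text \<open>Multiplication by the unit is trivial, so the rows at \<open>B1\<close> expose the
  scalar coefficients. The fourth equation pairs component 1 with 4 and 2 with 3, so it alone
  already has zero kernel.\<close>

lemma nondegenerate_Qt_tuple: "nondegenerate_tuple (Qt_tuple t)"
  unfolding nondegenerate_tuple_def
proof (intro conjI allI impI)
  fix c :: "4 \<times> bas \<Rightarrow> real" and x :: "4 \<times> bas"
  assume eq0: "(\<Sum>l\<in>UNIV. c l *\<^sub>R Qt_tuple t $ l) = 0"
  obtain l b where x: "x = (l, b)" by force
  have "(\<Sum>l\<in>UNIV. c (l, b) *\<^sub>R base_coeff l i j) = 0" for i j
  proof -
    have "(\<Sum>l\<in>UNIV. c l *\<^sub>R Qt_tuple t $ l) $ (i, B1) $ (j, b) = 0"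
      by (simp add: eq0)
    moreover have "(\<Sum>l\<in>UNIV. c l *\<^sub>R Qt_tuple t $ l) $ (i, B1) $ (j, b)
       = (\<Sum>l\<in>UNIV. c (l, b) *\<^sub>R base_coeff l i j)"
      unfolding sum_UNIV_prod sum_bas
      by (cases b) (simp_all add: Qt_tuple_def axis_def)
    ultimately show ?thesis by simp
  qed
  \<comment> \<open>The entry (2, 1) gives \<open>c (1, b) + \<i> * c (2, b) = 0\<close>, which
    splits because the coefficients are real; the other two entries isolate equations 3 and
    4.\<close>
  from this[of 2 1] this[of 2 2] this[of 1 4]
  have "c (1, b) = 0" "c (2, b) = 0" "c (3, b) = 0" "c (4, b) = 0"
    by (auto simp: sum_4 base_coeff_def complex_eq_iff)
  then show "c x = 0" using exhaust_4[of l] by (auto simp: x)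
next
  fix z :: "complex^(4 \<times> bas)"
  assume ker: "\<forall>l. Qt_tuple t $ l *v z = 0"
  have *: "(\<Sum>j\<in>UNIV. base_coeff 4 i j * z $ (j, c)) = 0" for i c
  proof -
    have "(Qt_tuple t $ (4, c) *v z) $ (i, B1) = 0"
      using ker by simp
    moreover have "(\<Sum>b\<in>UNIV. of_real (bas_prod t b B1 $ c) * z $ (j, b)) = z $ (j, c)" for j
      by (cases c) (simp_all add: sum_bas axis_def)
    ultimately show ?thesis by (simp add: Qt_tuple_mult_vec)
  qed
  have "z $ (j, c) = 0" for j c
    using *[of 1 c] *[of 2 c] *[of 3 c] *[of 4 c] exhaust_4[of j]
    by (auto simp: sum_4 base_coeff_def)
  then show "z = 0" by (auto simp: vec_eq_iff)
qed

section \<open>A tangent vector field of weight 4\<close>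

lemma weighted_homogeneous_0: "weighted_homogeneous m (\<lambda>_. 0)"
  unfolding weighted_homogeneous_def by (rule exI[of _ "{}"]) auto

lemma weighted_homogeneous_add:
  assumes "weighted_homogeneous m F" "weighted_homogeneous m G"
  shows "weighted_homogeneous m (\<lambda>p. F p + G p)"
proof -
  obtain M c where M: "finite M" "\<forall>\<mu>\<in>M. monomial_weight \<mu> = m"
      "F = (\<lambda>p. \<Sum>\<mu>\<in>M. c \<mu> * monomial_value \<mu> p)"
    using assms(1) unfolding weighted_homogeneous_def by blast
  obtain N d where N: "finite N" "\<forall>\<mu>\<in>N. monomial_weight \<mu> = m"
      "G = (\<lambda>p. \<Sum>\<mu>\<in>N. d \<mu> * monomial_value \<mu> p)"
    using assms(2) unfolding weighted_homogeneous_def by blast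
  \<comment> \<open>Both coefficient families are extended by zero to the union, so that shared
    monomials add up.\<close>
  define e where "e \<mu> = (if \<mu> \<in> M then c \<mu> else 0) + (if \<mu> \<in> N then d \<mu> else 0)" for \<mu>
  have "F p = (\<Sum>\<mu>\<in>M \<union> N. (if \<mu> \<in> M then c \<mu> else 0) * monomial_value \<mu> p)" for p
    unfolding M(3) using M(1) N(1) by (intro sum.mono_neutral_cong_left) auto
  moreover have "G p = (\<Sum>\<mu>\<in>M \<union> N. (if \<mu> \<in> N then d \<mu> else 0) * monomial_value \<mu> p)" for p
    unfolding N(3) using M(1) N(1) by (intro sum.mono_neutral_cong_left) auto
  ultimately have "(\<lambda>p. F p + G p) = (\<lambda>p. \<Sum>\<mu>\<in>M \<union> N. e \<mu> * monomial_value \<mu> p)"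
    by (simp add: e_def distrib_right sum.distrib)
  then show ?thesis
    unfolding weighted_homogeneous_def
    using M(1,2) N(1,2) by (intro exI[of _ "M \<union> N"] exI[of _ e]) auto
qed

lemma weighted_homogeneous_zww:
  "weighted_homogeneous 5
     (\<lambda>p :: ('n::finite, 'k::finite) pt. c * (fst p $ i * snd p $ j * snd p $ k))"
proof -
  \<comment> \<open>The exponents of the two \<open>w\<close> factors are added, which covers
    \<open>j = k\<close>.\<close>
  define \<mu> :: "('n \<Rightarrow> nat) \<times> ('k \<Rightarrow> nat)"
    where "\<mu> = (\<lambda>x. if x = i then 1 else 0, \<lambda>x. (if x = j then 1 else 0) + (if x = k then 1 else 0))"
  have pow: "a ^ (if P then 1 else 0) = (if P then a else 1)" for a :: complex and P
    by simp
  have "monomial_weight \<mu> = 5"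
    by (simp add: monomial_weight_def \<mu>_def sum.distrib flip: of_nat_sum)
  moreover have "monomial_value \<mu> p = fst p $ i * snd p $ j * snd p $ k" for p
    by (simp add: monomial_value_def \<mu>_def case_prod_beta power_add prod.distrib pow mult.assoc)
  ultimately show ?thesis
    unfolding weighted_homogeneous_def
    by (intro exI[of _ "{\<mu>}"] exI[of _ "\<lambda>_. c"]) auto
qed

section \<open>Complex differentiability of scalar functions at a point\<close>

definition cdiff_at :: "('n::finite, 'k::finite) pt \<Rightarrow> (('n, 'k) pt \<Rightarrow> complex) \<Rightarrow> bool" where
  "cdiff_at p F \<longleftrightarrow> (\<exists>D. (F has_derivative D) (at p) \<and> (\<forall>c v. D (cscale c v) = c * D v))"

lemma cdiff_at_const: "cdiff_at p (\<lambda>_. c)"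
  unfolding cdiff_at_def by (rule exI[of _ "\<lambda>_. 0"]) auto

lemma cdiff_at_add:
  assumes "cdiff_at p F" "cdiff_at p G"
  shows "cdiff_at p (\<lambda>q. F q + G q)"
proof -
  obtain D E where D: "(F has_derivative D) (at p)" "\<And>c v. D (cscale c v) = c * D v"
    and E: "(G has_derivative E) (at p)" "\<And>c v. E (cscale c v) = c * E v"
    using assms unfolding cdiff_at_def by blast
  show ?thesis
    unfolding cdiff_at_def
    by (rule exI[of _ "\<lambda>v. D v + E v"])
       (intro conjI has_derivative_add[OF D(1) E(1)], simp add: D(2) E(2) algebra_simps)
qed

lemma cdiff_at_mult:
  assumes "cdiff_at p F" "cdiff_at p G"
  shows "cdiff_at p (\<lambda>q. F q * G q)"
proof -
  obtain D E where D: "(F has_derivative D) (at p)" "\<And>c v. D (cscale c v) = c * D v"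
    and E: "(G has_derivative E) (at p)" "\<And>c v. E (cscale c v) = c * E v"
    using assms unfolding cdiff_at_def by blast
  show ?thesis
    unfolding cdiff_at_def
    by (rule exI[of _ "\<lambda>v. F p * E v + D v * G p"])
       (intro conjI has_derivative_mult[OF D(1) E(1)], simp add: D(2) E(2) algebra_simps)
qed

lemma cdiff_at_diff:
  assumes "cdiff_at p F" "cdiff_at p G"
  shows "cdiff_at p (\<lambda>q. F q - G q)"
  using cdiff_at_add[OF assms(1) cdiff_at_mult[OF cdiff_at_const[of p "-1"] assms(2)]] by simp

lemma cdiff_at_fst: "cdiff_at p (\<lambda>q. fst q $ i)"
  unfolding cdiff_at_def
  by (rule exI[of _ "\<lambda>q. fst q $ i"])
     (auto intro!: bounded_linear_imp_has_derivative bounded_linear_compose[OF bounded_linear_vec_nth]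
       bounded_linear_fst simp: cscale_def)

lemma cdiff_at_snd: "cdiff_at p (\<lambda>q. snd q $ i)"
  unfolding cdiff_at_def
  by (rule exI[of _ "\<lambda>q. snd q $ i"])
     (auto intro!: bounded_linear_imp_has_derivative bounded_linear_compose[OF bounded_linear_vec_nth]
       bounded_linear_snd simp: cscale_def)

section \<open>Polarization and the differential of the defining map\<close>

definition polar_form :: "complex^'n^'n^'k \<Rightarrow> complex^'n \<Rightarrow> complex^'n \<Rightarrow> real^'k" where
  "polar_form H z w = (\<chi> l. Re (\<Sum>a\<in>UNIV. (H $ l *v z) $ a * cnj (w $ a)))"

lemma hermitian_form_polar: "hermitian_form H z = polar_form H z z"
  by (simp add: hermitian_form_def polar_form_def)

lemma bounded_bilinear_polar_form:
  "bounded_bilinear (polar_form H :: complex^'n::finite \<Rightarrow> complex^'n \<Rightarrow> real^'k::finite)"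
  unfolding bilinear_conv_bounded_bilinear[symmetric] bilinear_def polar_form_def
  by (auto intro!: linearI simp: vec_eq_iff matrix_vector_right_distrib distrib_left distrib_right
      sum.distrib sum_subtractf matrix_vector_mult_def scaleR_sum_right sum_distrib_left algebra_simps)

lemma polar_form_commute:
  assumes "hermitian_tuple H"
  shows "polar_form H z w = polar_form H w z"
proof -
  have H: "cnj (H $ l $ a $ b) = H $ l $ b $ a" for l a b
    using assms by (metis complex_cnj_cnj hermitian_matrix_def hermitian_tuple_def)
  have "cnj (\<Sum>a\<in>UNIV. (H $ l *v z) $ a * cnj (w $ a)) = (\<Sum>a\<in>UNIV. (H $ l *v w) $ a * cnj (z $ a))" for l
  proof -
    have "cnj (\<Sum>a\<in>UNIV. (H $ l *v z) $ a * cnj (w $ a)) =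
        (\<Sum>a\<in>UNIV. \<Sum>b\<in>UNIV. H $ l $ b $ a * cnj (z $ b) * w $ a)"
      by (simp add: matrix_vector_mult_def sum_distrib_right H)
    also have "\<dots> = (\<Sum>b\<in>UNIV. \<Sum>a\<in>UNIV. H $ l $ b $ a * cnj (z $ b) * w $ a)"
      by (rule sum.swap)
    also have "\<dots> = (\<Sum>a\<in>UNIV. (H $ l *v w) $ a * cnj (z $ a))"
      by (simp add: matrix_vector_mult_def sum_distrib_left mult_ac)
    finally show ?thesis .
  qed
  from arg_cong[OF this, of Re] show ?thesis
    by (simp only: polar_form_def cnj.sel)
qed

text \<open>The differential of a quadratic form is twice its polarization; symmetry of the latter
  merges the two terms of the product rule.\<close>

lemma defining_map_has_derivative:
  fixes H :: "complex^'n::finite^'n^'k::finite"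
  assumes "hermitian_tuple H"
  shows "(defining_map H has_derivative
    (\<lambda>v. (\<chi> l. Im (snd v $ l)) - 2 *\<^sub>R polar_form H (fst v) (fst p))) (at p)"
proof -
  interpret bounded_bilinear "polar_form H" by (rule bounded_bilinear_polar_form)
  have "linear (\<lambda>v::('n, 'k) pt. (\<chi> l. Im (snd v $ l)))"
    by (rule linearI) (simp_all add: vec_eq_iff)
  then have 1: "((\<lambda>v. (\<chi> l. Im (snd v $ l))) has_derivative (\<lambda>v. (\<chi> l. Im (snd v $ l)))) (at p)"
    by (simp add: linear_conv_bounded_linear bounded_linear_imp_has_derivative)
  have 2: "(fst has_derivative fst) (at p)"
    by (rule bounded_linear_imp_has_derivative[OF bounded_linear_fst])
  have "(defining_map H has_derivative
    (\<lambda>v. (\<chi> l. Im (snd v $ l)) - (polar_form H (fst p) (fst v) + polar_form H (fst v) (fst p)))) (at p)"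
    unfolding defining_map_def hermitian_form_polar
    by (rule has_derivative_diff[OF 1 FDERIV[OF 2 2]])
  then show ?thesis
    by (simp add: polar_form_commute[OF assms, of "fst p"] scaleR_2)
qed

definition resonance :: "(4 \<times> bas, 4 \<times> bas) pt \<Rightarrow> complex" where
  "resonance p = 2 * (fst p $ (1, B1) * snd p $ (3, B1))
     - fst p $ (2, B1) * (snd p $ (1, B1) - \<i> * snd p $ (2, B1))"

text \<open>The name refers to the weight 4 of the field; its coefficients are cubic polynomials of
  weight 5.\<close>

definition quartic_field :: "(4 \<times> bas, 4 \<times> bas) vfield" where
  "quartic_field p =
     (axis (3, Bp) (- \<i> * (snd p $ (1, B1) + \<i> * snd p $ (2, B1)) * resonance p)
        + axis (4, Bp) (2 * \<i> * snd p $ (3, B1) * resonance p), 0)"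

lemma has_weight_quartic_field: "has_weight 4 quartic_field"
proof -
  let ?m = "\<lambda>i j k (p :: (4 \<times> bas, 4 \<times> bas) pt). fst p $ (i, B1) * snd p $ (j, B1) * snd p $ (k, B1)"
  have "fst (quartic_field p) $ x =
     (if x = (3, Bp) then - 2 * \<i> * ?m 1 3 1 p + 2 * ?m 1 3 2 p + \<i> * ?m 2 1 1 p + \<i> * ?m 2 2 2 p
      else if x = (4, Bp) then 4 * \<i> * ?m 1 3 3 p + - 2 * \<i> * ?m 2 3 1 p + - 2 * ?m 2 3 2 p
      else 0)" for x p
    by (auto simp: quartic_field_def resonance_def axis_def algebra_simps)
  moreover have "weighted_homogeneous 5
      (\<lambda>p. - 2 * \<i> * ?m 1 3 1 p + 2 * ?m 1 3 2 p + \<i> * ?m 2 1 1 p + \<i> * ?m 2 2 2 p)"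
    "weighted_homogeneous 5 (\<lambda>p. 4 * \<i> * ?m 1 3 3 p + - 2 * \<i> * ?m 2 3 1 p + - 2 * ?m 2 3 2 p)"
    by (intro weighted_homogeneous_add weighted_homogeneous_zww)+
  ultimately have "weighted_homogeneous 5 (\<lambda>p. fst (quartic_field p) $ x)" for x
    by (cases "x = (3, Bp)"; cases "x = (4, Bp)") (simp_all add: weighted_homogeneous_0)
  then show ?thesis
    by (simp add: has_weight_def quartic_field_def weighted_homogeneous_0)
qed

lemma holomorphic_quartic_field: "holomorphic_near_0 quartic_field"
proof -
  have "\<exists>D. (quartic_field has_derivative D) (at p) \<and> (\<forall>c v. D (cscale c v) = cscale c (D v))" for p
  proof -
    define L :: "4 \<times> bas \<Rightarrow> complex \<Rightarrow> (4 \<times> bas, 4 \<times> bas) pt" where "L x c = (axis x c, 0)" for x c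
    have "linear (L x)" for x
      by (rule linearI) (auto simp: L_def vec_eq_iff axis_def)
    then have L: "bounded_linear (L x)" for x
      by (simp add: linear_conv_bounded_linear)
    define f where "f p = - \<i> * (snd p $ (1, B1) + \<i> * snd p $ (2, B1)) * resonance p" for p
    define g where "g p = 2 * \<i> * snd p $ (3, B1) * resonance p" for p
    have res: "cdiff_at p resonance"
      unfolding resonance_def[abs_def]
      by (intro cdiff_at_diff cdiff_at_mult cdiff_at_const cdiff_at_fst cdiff_at_snd)
    have "cdiff_at p f" "cdiff_at p g"
      unfolding f_def g_def
      by (intro cdiff_at_add cdiff_at_mult cdiff_at_const cdiff_at_fst cdiff_at_snd res)+
    then obtain F G where F: "(f has_derivative F) (at p)" "\<And>c v. F (cscale c v) = c * F v"
      and G: "(g has_derivative G) (at p)" "\<And>c v. G (cscale c v) = c * G v"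
      unfolding cdiff_at_def by blast
    have eq: "quartic_field = (\<lambda>q. L (3, Bp) (f q) + L (4, Bp) (g q))"
      by (simp add: fun_eq_iff quartic_field_def L_def f_def g_def)
    have "(quartic_field has_derivative (\<lambda>v. L (3, Bp) (F v) + L (4, Bp) (G v))) (at p)"
      unfolding eq by (intro has_derivative_add bounded_linear.has_derivative[OF L] F(1) G(1))
    moreover have "L (3, Bp) (F (cscale c v)) + L (4, Bp) (G (cscale c v))
        = cscale c (L (3, Bp) (F v) + L (4, Bp) (G v))" for c v
      unfolding F(2) G(2) by (auto simp: L_def cscale_def vec_eq_iff axis_def)
    ultimately show ?thesis by blast
  qed
  then show ?thesis
    unfolding holomorphic_near_0_def by (intro exI[of _ UNIV]) auto
qed

text \<open>On the scalar quadric the imaginary parts of the \<open>w\<close> cancel both in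
  \<open>G\<close> and in \<open>2 * w3 * cnj z1 - (w1 + \<i> * w2) * cnj z2\<close>, so the latter
  is \<open>cnj G\<close>. The expression is therefore \<i> times the squared modulus of
  \<open>G\<close>. In real coordinates this is a polynomial identity.\<close>

lemma resonance_tangency:
  assumes "Im w1 = Re (z1 * cnj z2 + z2 * cnj z1)"
    and "Im w2 = Re (\<i> * (z1 * cnj z2) - \<i> * (z2 * cnj z1))"
    and "Im w3 = Re (z2 * cnj z2)"
  defines "G \<equiv> 2 * (z1 * w3) - z2 * (w1 - \<i> * w2)"
  shows "Re ((- \<i> * (w1 + \<i> * w2) * G) * cnj z2 + (2 * \<i> * w3 * G) * cnj z1) = 0"
proof -
  obtain a b where z1: "z1 = Complex a b" by (cases z1)
  obtain c d where z2: "z2 = Complex c d" by (cases z2)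
  obtain u1 v1 where w1: "w1 = Complex u1 v1" by (cases w1)
  obtain u2 v2 where w2: "w2 = Complex u2 v2" by (cases w2)
  obtain u3 v3 where w3: "w3 = Complex u3 v3" by (cases w3)
  have v: "v1 = 2 * (a * c + b * d)" "v2 = 2 * (a * d - b * c)" "v3 = c * c + d * d"
    using assms(1-3) by (simp_all add: z1 z2 w1 w2 w3 algebra_simps)
  show ?thesis
    unfolding G_def by (simp add: z1 z2 w1 w2 w3 v) algebra
qed

text \<open>A multiple of \<open>p\<close> has nonzero product only with the unit, and components 3
  and 4 occur only in the fourth equation. So a single term survives, and
  \<open>resonance_tangency\<close> kills it.\<close>

lemma polar_form_quartic_field:
  assumes "p \<in> cr_quadric (Qt_tuple t)"
  shows "polar_form (Qt_tuple t) (fst (quartic_field p)) (fst p) = 0"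
proof -
  obtain z w where p: "p = (z, w)" by force
  \<comment> \<open>The coordinates along \<open>B1\<close> multiply as scalars, hence satisfy the
    scalar equations.\<close>
  have im: "Im (w $ (l, B1)) = Re (\<Sum>i\<in>UNIV. \<Sum>j\<in>UNIV. base_coeff l i j * (z $ (j, B1) * cnj (z $ (i, B1))))" for l
  proof -
    have "Im (w $ (l, B1)) = hermitian_form (Qt_tuple t) z $ (l, B1)"
      using assms by (simp add: p cr_quadric_def quadric_of_form_def vec_eq_iff)
    moreover have "alg_mult t x y $ B1 = x $ B1 * y $ B1" for x y :: "complex^bas"
      by (simp add: alg_mult_def sum_bas axis_def)
    ultimately show ?thesis
      by (simp add: hermitian_form_def Qt_tuple_form alg_comp_def del: Re_sum times_complex.sel)
  qed
  define f where "f = - \<i> * (w $ (1, B1) + \<i> * w $ (2, B1)) * resonance p"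
  define g where "g = 2 * \<i> * w $ (3, B1) * resonance p"
  have "Re (f * cnj (z $ (2, B1)) + g * cnj (z $ (1, B1))) = 0"
    unfolding f_def g_def resonance_def p fst_conv snd_conv
    by (rule resonance_tangency) (simp_all add: im sum_4 base_coeff_def)
  then have fg: "Re (f * cnj (z $ (2, B1))) + Re (g * cnj (z $ (1, B1))) = 0"
    by simp
  have row: "(Qt_tuple t $ (l, c) *v fst (quartic_field p)) $ (i, a) =
      (if a = B1 \<and> c = Bp then base_coeff l i 3 * f + base_coeff l i 4 * g else 0)" for l c i a
  proof -
    have q: "fst (quartic_field p) $ (j, b) =
        (if b = Bp then if j = 3 then f else if j = 4 then g else 0 else 0)" for j b
      by (simp add: quartic_field_def f_def g_def p axis_def)
    have "(\<Sum>b\<in>UNIV. of_real (bas_prod t b a $ c) * fst (quartic_field p) $ (j, b)) =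
        (if a = B1 \<and> c = Bp then fst (quartic_field p) $ (j, Bp) else 0)" for j
      by (cases a) (simp_all add: sum_bas q axis_def)
    then show ?thesis
      unfolding Qt_tuple_mult_vec sum_4 q by simp
  qed
  have "Re (\<Sum>x\<in>UNIV. (Qt_tuple t $ (l, c) *v fst (quartic_field p)) $ x * cnj (z $ x)) = 0" for l c
  proof (cases "c = Bp")
    case True
    have "(\<Sum>x\<in>UNIV. (Qt_tuple t $ (l, c) *v fst (quartic_field p)) $ x * cnj (z $ x)) =
        (\<Sum>i\<in>UNIV. (base_coeff l i 3 * f + base_coeff l i 4 * g) * cnj (z $ (i, B1)))"
      unfolding sum_UNIV_prod row sum_bas by (simp add: True)
    then show ?thesis
      using exhaust_4[of l] fg
      by (elim disjE) (simp_all only: sum_4, simp_all add: base_coeff_def)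
  qed (simp add: sum_UNIV_prod row)
  then show ?thesis
    unfolding polar_form_def p fst_conv vec_eq_iff by simp
qed

lemma tangent_quartic_field: "tangent_near_0 (Qt_tuple t) quartic_field"
  unfolding tangent_near_0_def
proof (intro always_eventually allI impI)
  fix p :: "(4 \<times> bas, 4 \<times> bas) pt"
  assume "p \<in> cr_quadric (Qt_tuple t)"
  moreover have "snd (quartic_field p) = 0"
    by (simp add: quartic_field_def)
  ultimately show "\<exists>D. (defining_map (Qt_tuple t) has_derivative D) (at p) \<and> D (quartic_field p) = 0"
    using defining_map_has_derivative[OF hermitian_Qt_tuple, of t p]
    by - (intro exI conjI, assumption,
        simp add: polar_form_quartic_field vec_eq_iff)
qed

lemma germ_quartic_field: "germ_0 quartic_field \<noteq> germ_0 (\<lambda>_. 0)"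
proof
  assume "germ_0 quartic_field = germ_0 (\<lambda>_. 0)"
  moreover have "quartic_field \<in> germ_0 quartic_field"
    by (simp add: germ_0_def)
  ultimately have ev: "\<forall>\<^sub>F p in nhds 0. quartic_field p = 0"
    by (simp add: germ_0_def)
  \<comment> \<open>On this ray \<open>z\<^sub>1 = w\<^sub>3 = e\<close> and all other coordinates
    vanish, so the coefficient at \<open>(4, Bp)\<close> is \<open>4 * \<i> * e ^ 3\<close>.\<close>
  define P :: "real \<Rightarrow> (4 \<times> bas, 4 \<times> bas) pt"
    where "P e = e *\<^sub>R (axis (1, B1) 1, axis (3, B1) 1)" for e
  have "(P \<longlongrightarrow> 0) (at_right 0)"
    unfolding P_def by (rule tendsto_eq_intros refl)+ (simp add: zero_prod_def)
  with ev have "\<forall>\<^sub>F e in at_right 0. quartic_field (P e) = 0"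
    by (rule eventually_compose_filterlim)
  with eventually_at_right_less[of "0 :: real"]
  have "\<forall>\<^sub>F e in at_right 0. e > 0 \<and> quartic_field (P e) = 0"
    by (rule eventually_conj)
  then obtain e where "e > 0" "quartic_field (P e) = 0"
    using eventually_happens'[OF trivial_limit_at_right_real] by blast
  then have "fst (quartic_field (P e)) $ (4, Bp) = 0" "e > 0"
    by simp_all
  then show False
    by (simp add: quartic_field_def P_def axis_def resonance_def)
qed

lemma exceptional_Qt: "exceptional_quadric (Qt t)"
proof -
  have "germ_0 quartic_field \<in> aut_component (Qt_tuple t) 4"
    unfolding aut_component_def aut_def
    using holomorphic_quartic_field tangent_quartic_field has_weight_quartic_field by blast
  then have "aut_component (Qt_tuple t) 4 \<noteq> {germ_0 (\<lambda>_. 0)}"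
    using germ_quartic_field by auto
  then show ?thesis
    unfolding exceptional_quadric_def
    using hermitian_Qt_tuple Qt_eq_cr_quadric nondegenerate_Qt_tuple
    by (intro exI[of _ "Qt_tuple t"] conjI exI[of _ 4]) auto
qed

section \<open>The pencil invariant\<close>

text \<open>The case distinction runs over the 24 orderings of the four points: the five other values of the
  cross ratio of the points given by \<open>t\<close> lie outside the interval from \<open>-1\<close> to \<open>0\<close> containing \<open>1 - s\<close>.\<close>

lemma cross_ratio_unique:
  fixes s t :: real
  assumes s: "1 < s" "s < 2" and t: "1 < t" "t < 2"
  defines "R \<equiv> {(0, 1), (1, 0), (1, -1), (t, -1)}" and "br \<equiv> \<lambda>u v. fst u * snd v - snd u * fst v"
  assumes R: "r1 \<in> R" "r2 \<in> R" "r3 \<in> R" "r4 \<in> R"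
    and ratio: "br r1 r2 * br r3 r4 = (1 - s) * (br r1 r3 * br r2 r4)"
    and ne: "br r1 r3 * br r2 r4 \<noteq> 0" "br r1 r2 * br r3 r4 \<noteq> 0"
  shows "s = t"
proof -
  have "(s - 1) * (t - 1) < 1" "(s - 1) * t < t" "0 < (s - 1) * (t - 1)" "0 < (s - 1) * t"
    using mult_strict_mono[of "s - 1" 1 "t - 1" 1] s t by auto
  then have st: "s * t < s + t" "s * t < 2 * t" "s + t < s * t + 1" "t < s * t"
    by (simp_all add: algebra_simps)
  have "0 < s * ((t - 1) * (t - 1))"
    using s t by simp
  then have "s * (t * 2) \<noteq> s + s * (t * t)"
    by (simp add: algebra_simps)
  then show ?thesis
    using R ratio ne s t st unfolding R_def br_def
    by (elim insertE emptyE) (simp_all add: algebra_simps)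
qed

text \<open>The factors are the values on the squares of \<open>E1\<close>, \<open>E4\<close>,
  \<open>E2\<close>, \<open>E3\<close> of a functional with values \<open>x\<close> at
  \<open>p\<close> and \<open>y\<close> at \<open>q\<close>.\<close>

definition pencil :: "real \<Rightarrow> real \<Rightarrow> real \<Rightarrow> real" where
  "pencil t x y = x * y * (x + y) * (x + t * y)"

lemma pencil_zeroE:
  assumes "pencil t x y = 0"
  obtains k r where "x = k * fst r" "y = k * snd r" "r \<in> {(0, 1), (1, 0), (1, -1), (t, -1)}"
proof -
  consider "x = 0" | "y = 0" | "x + y = 0" | "x + t * y = 0"
    using assms by (auto simp: pencil_def)
  then show ?thesis
  proof cases
    case 1 then show ?thesis by (intro that[of y "(0, 1)"]) auto
  next
    case 2 then show ?thesis by (intro that[of x "(1, 0)"]) auto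
  next
    case 3 then show ?thesis by (intro that[of x "(1, -1)"]) auto
  next
    case 4 then show ?thesis by (intro that[of "- y" "(t, -1)"]) (auto simp: eq_neg_iff_add_eq_0 mult.commute)
  qed
qed

text \<open>The linear substitution carries the four root lines of one form to root lines of the
  other and preserves their cross ratio.\<close>

lemma pencil_rigid:
  fixes s t :: real
  assumes s: "1 < s" "s < 2" and t: "1 < t" "t < 2"
    and iff: "\<And>x y. pencil s x y = 0 \<longleftrightarrow> pencil t (a * x + b * y) (c * x + d * y) = 0"
  shows "s = t"
proof -
  define \<Delta> where "\<Delta> = a * d - b * c"
  \<comment> \<open>Images of the roots (0, 1), (1, 0), (1, -1), (s, -1), which in this order have
    cross ratio \<open>1 - s\<close>.\<close>
  have "pencil t b d = 0" "pencil t a c = 0" "pencil t (a - b) (c - d) = 0"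
      "pencil t (s * a - b) (s * c - d) = 0"
    using iff[of 0 1] iff[of 1 0] iff[of 1 "-1"] iff[of s "-1"] by (simp_all add: pencil_def mult.commute)
  then obtain k1 k2 k3 k4 r1 r2 r3 r4 where
      1: "b = k1 * fst r1" "d = k1 * snd r1" and 2: "a = k2 * fst r2" "c = k2 * snd r2"
      and 3: "a - b = k3 * fst r3" "c - d = k3 * snd r3"
      and 4: "s * a - b = k4 * fst r4" "s * c - d = k4 * snd r4"
      and r: "r1 \<in> {(0, 1), (1, 0), (1, -1), (t, -1)}" "r2 \<in> {(0, 1), (1, 0), (1, -1), (t, -1)}"
        "r3 \<in> {(0, 1), (1, 0), (1, -1), (t, -1)}" "r4 \<in> {(0, 1), (1, 0), (1, -1), (t, -1)}"
    by (elim pencil_zeroE)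
  \<comment> \<open>A degenerate substitution would map the non-root (1, 1) to a multiple of the
    image of a root.\<close>
  have "\<Delta> \<noteq> 0"
  proof
    assume "\<Delta> = 0"
    have "pencil s 1 1 \<noteq> 0"
      using s by (simp add: pencil_def)
    then have ne: "pencil t (a + b) (c + d) \<noteq> 0"
      using iff[of 1 1] by simp
    have hom: "pencil t (k * x) (k * y) = k ^ 4 * pencil t x y" for k x y
      by (simp add: pencil_def power4_eq_xxxx algebra_simps)
    show False
    proof (cases "b = 0 \<and> d = 0")
      case True
      then show False using ne \<open>pencil t a c = 0\<close> by simp
    next
      case False
      obtain k where "a = k * b" "c = k * d"
      proof (cases "b = 0")
        case True
        then show ?thesis
          using False \<open>\<Delta> = 0\<close> that[of "c / d"] by (simp add: \<Delta>_def)
      next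
        case False
        then show ?thesis
          using \<open>\<Delta> = 0\<close> that[of "a / b"] by (simp add: \<Delta>_def field_simps)
      qed
      then have "a + b = (k + 1) * b" "c + d = (k + 1) * d"
        by (simp_all add: algebra_simps)
      then show False
        using ne hom[of "k + 1" b d] \<open>pencil t b d = 0\<close> by simp
    qed
  qed
  define br where "br u v = fst u * snd v - snd u * fst v" for u v :: "real \<times> real"
  \<comment> \<open>Each point occurs once in the numerator and once in the denominator of the cross
    ratio, so the scale factors collect to the same \<open>K\<close> in both.\<close>
  define K where "K = k1 * k2 * k3 * k4"
  have "K * (br r1 r2 * br r3 r4) = (b * c - d * a) * ((a - b) * (s * c - d) - (c - d) * (s * a - b))"
    unfolding 3 4 unfolding 1 2 by (simp add: br_def K_def algebra_simps)
  also have "\<dots> = (1 - s) * \<Delta>\<^sup>2"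
    by (simp add: \<Delta>_def power2_eq_square algebra_simps)
  finally have N: "K * (br r1 r2 * br r3 r4) = (1 - s) * \<Delta>\<^sup>2" .
  have "K * (br r1 r3 * br r2 r4) = (b * (c - d) - d * (a - b)) * (a * (s * c - d) - c * (s * a - b))"
    unfolding 3 4 unfolding 1 2 by (simp add: br_def K_def algebra_simps)
  also have "\<dots> = \<Delta>\<^sup>2"
    by (simp add: \<Delta>_def power2_eq_square algebra_simps)
  finally have D: "K * (br r1 r3 * br r2 r4) = \<Delta>\<^sup>2" .
  have "K \<noteq> 0" and ne: "br r1 r3 * br r2 r4 \<noteq> 0" "br r1 r2 * br r3 r4 \<noteq> 0"
    using N D \<open>\<Delta> \<noteq> 0\<close> s by auto
  have "K * (br r1 r2 * br r3 r4) = K * ((1 - s) * (br r1 r3 * br r2 r4))"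
    unfolding N D[symmetric] by simp
  then have "br r1 r2 * br r3 r4 = (1 - s) * (br r1 r3 * br r2 r4)"
    using \<open>K \<noteq> 0\<close> by simp
  then show ?thesis
    using cross_ratio_unique[OF s t r] ne unfolding br_def by blast
qed

section \<open>Forms recovered from quadrics, and kernels of real combinations\<close>

lemma quadric_of_form_inject:
  fixes \<phi> \<psi> :: "complex^'n \<Rightarrow> real^'k"
  assumes "quadric_of_form \<phi> = quadric_of_form \<psi>"
  shows "\<phi> = \<psi>"
proof
  fix z
  define w :: "complex^'k" where "w = (\<chi> l. Complex 0 (\<phi> z $ l))"
  have "(z, w) \<in> quadric_of_form \<phi>"
    by (simp add: quadric_of_form_def w_def vec_eq_iff)
  then have "(z, w) \<in> quadric_of_form \<psi>"
    by (simp add: assms)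
  then show "\<phi> z = \<psi> z"
    by (simp add: quadric_of_form_def w_def vec_eq_iff)
qed

text \<open>For a Hermitian form \<open>\<phi>\<close> this is the kernel of the matrix of \<open>c \<bullet> \<phi>\<close>.\<close>

definition form_kernel :: "(complex^'n \<Rightarrow> real^'k) \<Rightarrow> real^'k \<Rightarrow> (complex^'n) set" where
  "form_kernel \<phi> c = {z. \<forall>w. c \<bullet> \<phi> (z + w) = c \<bullet> \<phi> z + c \<bullet> \<phi> w}"

text \<open>States that the kernel has dimension greater than \<open>4\<close>.\<close>

definition singular_functional :: "(complex^'n \<Rightarrow> real^'k) \<Rightarrow> real^'k \<Rightarrow> bool" where
  "singular_functional \<phi> c \<longleftrightarrow>
     (\<forall>f :: complex^'n^4. \<exists>z. z \<noteq> 0 \<and> z \<in> form_kernel \<phi> c \<and> f *v z = 0)"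

text \<open>The kernel is moved by the bijection \<open>C\<close>; the four test functionals are
  composed with \<open>C\<close> or its inverse to match.\<close>

lemma singular_functional_transform_form:
  fixes C :: "complex^'n^'n" and \<rho> :: "real^'k^'k"
  assumes "invertible C"
  shows "singular_functional (transform_form C \<rho> \<phi>) c \<longleftrightarrow>
    singular_functional \<phi> (c v* matrix_inv \<rho>)"
proof -
  obtain D where "C ** D = mat 1" "D ** C = mat 1"
    using assms unfolding invertible_def by blast
  then have DC: "D *v (C *v z) = z" and CD: "C *v (D *v z) = z" for z
    by (simp_all add: matrix_vector_mul_assoc)
  have ker: "z \<in> form_kernel (transform_form C \<rho> \<phi>) c \<longleftrightarrow>
      C *v z \<in> form_kernel \<phi> (c v* matrix_inv \<rho>)" for z
    unfolding form_kernel_def transform_form_def mem_Collect_eq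
      dot_lmul_matrix[symmetric] matrix_vector_right_distrib
    by (metis CD)
  show ?thesis
    unfolding singular_functional_def ker
  proof (intro iffI allI)
    fix f :: "complex^'n^4"
    assume "\<forall>f :: complex^'n^4. \<exists>z. z \<noteq> 0 \<and> C *v z \<in> form_kernel \<phi> (c v* matrix_inv \<rho>) \<and> f *v z = 0"
    then obtain z where "z \<noteq> 0" "C *v z \<in> form_kernel \<phi> (c v* matrix_inv \<rho>)" "(f ** C) *v z = 0"
      by blast
    then show "\<exists>z. z \<noteq> 0 \<and> z \<in> form_kernel \<phi> (c v* matrix_inv \<rho>) \<and> f *v z = 0"
      by (metis DC matrix_vector_mul_assoc matrix_vector_mult_0_right)
  next
    fix f :: "complex^'n^4"
    assume "\<forall>f :: complex^'n^4. \<exists>z. z \<noteq> 0 \<and> z \<in> form_kernel \<phi> (c v* matrix_inv \<rho>) \<and> f *v z = 0"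
    then obtain z where "z \<noteq> 0" "z \<in> form_kernel \<phi> (c v* matrix_inv \<rho>)" "(f ** D) *v z = 0"
      by blast
    then show "\<exists>z. z \<noteq> 0 \<and> C *v z \<in> form_kernel \<phi> (c v* matrix_inv \<rho>) \<and> f *v z = 0"
      by (metis CD matrix_vector_mul_assoc matrix_vector_mult_0_right)
  qed
qed

text \<open>The additivity defect at \<open>z\<close>, \<open>w\<close> is twice the real inner
  product of the matrix image \<open>u\<close> of \<open>z\<close> with \<open>w\<close>; it
  vanishes for every \<open>w\<close> only if \<open>u = 0\<close>.\<close>

lemma form_kernel_hermitian_form:
  fixes H :: "complex^'n^'n^'k"
  assumes "hermitian_tuple H"
  shows "z \<in> form_kernel (hermitian_form H) c \<longleftrightarrow> (\<Sum>l\<in>UNIV. c $ l *\<^sub>R H $ l) *v z = 0"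
proof -
  interpret bounded_bilinear "polar_form H" by (rule bounded_bilinear_polar_form)
  define u where "u = (\<Sum>l\<in>UNIV. c $ l *\<^sub>R H $ l) *v z"
  have u: "u $ a = (\<Sum>l\<in>UNIV. c $ l *\<^sub>R (H $ l *v z) $ a)" for a
  proof -
    have "u $ a = (\<Sum>b\<in>UNIV. \<Sum>l\<in>UNIV. c $ l *\<^sub>R (H $ l $ a $ b * z $ b))"
      by (simp add: u_def matrix_vector_mult_def sum_distrib_right)
    also have "\<dots> = (\<Sum>l\<in>UNIV. \<Sum>b\<in>UNIV. c $ l *\<^sub>R (H $ l $ a $ b * z $ b))"
      by (rule sum.swap)
    finally show ?thesis
      by (simp add: matrix_vector_mult_def scaleR_sum_right)
  qed
  have pol: "c \<bullet> polar_form H z w = u \<bullet> w" for w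
  proof -
    have "u \<bullet> w = Re (\<Sum>a\<in>UNIV. u $ a * cnj (w $ a))"
      by (simp add: inner_vec_def inner_complex_def)
    also have "(\<Sum>a\<in>UNIV. u $ a * cnj (w $ a)) =
        (\<Sum>a\<in>UNIV. \<Sum>l\<in>UNIV. c $ l *\<^sub>R ((H $ l *v z) $ a * cnj (w $ a)))"
      by (simp add: u sum_distrib_right)
    also have "\<dots> = (\<Sum>l\<in>UNIV. \<Sum>a\<in>UNIV. c $ l *\<^sub>R ((H $ l *v z) $ a * cnj (w $ a)))"
      by (rule sum.swap)
    also have "\<dots> = (\<Sum>l\<in>UNIV. c $ l *\<^sub>R (\<Sum>a\<in>UNIV. (H $ l *v z) $ a * cnj (w $ a)))"
      by (simp add: scaleR_sum_right)
    finally show ?thesis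
      by (simp add: inner_vec_def polar_form_def del: times_complex.sel)
  qed
  have "hermitian_form H (z + w) = hermitian_form H z + hermitian_form H w + 2 *\<^sub>R polar_form H z w" for w
    by (simp add: hermitian_form_polar add_left add_right polar_form_commute[OF assms, of w z] scaleR_2)
  then have "z \<in> form_kernel (hermitian_form H) c \<longleftrightarrow> (\<forall>w. u \<bullet> w = 0)"
    by (simp add: form_kernel_def inner_add_right pol)
  also have "\<dots> \<longleftrightarrow> u = 0"
    by (metis inner_eq_zero_iff inner_zero_left)
  finally show ?thesis by (simp add: u_def)
qed

text \<open>With \<open>d\<close> a linear functional on \<open>A\<^sub>t\<close> and \<open>x\<close> an element, this is \<open>d\<close> at the product of \<open>x\<close> and
  the basis element \<open>a\<close>.\<close>

definition dual_mult :: "real \<Rightarrow> (bas \<Rightarrow> real) \<Rightarrow> (bas \<Rightarrow> complex) \<Rightarrow> bas \<Rightarrow> complex" where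
  "dual_mult t d x a = (\<Sum>b\<in>UNIV. (\<Sum>c\<in>UNIV. of_real (d c * bas_prod t b a $ c)) * x b)"

lemma dual_mult_simps:
  "dual_mult t d x B1 = d B1 * x B1 + d E1 * x E1 + d E2 * x E2 + d E3 * x E3 + d E4 * x E4
     + d Bp * x Bp + d Bq * x Bq"
  "dual_mult t d x E1 = d E1 * x B1 + d Bp * x E1"
  "dual_mult t d x E2 = d E2 * x B1 + (d Bp + d Bq) * x E2"
  "dual_mult t d x E3 = d E3 * x B1 + (d Bp + t * d Bq) * x E3"
  "dual_mult t d x E4 = d E4 * x B1 + d Bq * x E4"
  "dual_mult t d x Bp = d Bp * x B1"
  "dual_mult t d x Bq = d Bq * x B1"
  by (simp_all add: dual_mult_def sum_bas axis_def algebra_simps)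

lemma dual_mult_0: "dual_mult t d (\<lambda>_. 0) a = 0"
  by (simp add: dual_mult_def)

section \<open>Singular functionals of the quadrics\<close>

definition functional_matrix :: "real \<Rightarrow> real^(4 \<times> bas) \<Rightarrow> complex^(4 \<times> bas)^(4 \<times> bas)" where
  "functional_matrix t c = (\<Sum>l\<in>UNIV. c $ l *\<^sub>R Qt_tuple t $ l)"

lemma functional_matrix_mult_vec:
  "(functional_matrix t c *v z) $ (i, a) =
    (\<Sum>j\<in>UNIV. \<Sum>l\<in>UNIV. base_coeff l i j * dual_mult t (\<lambda>b. c $ (l, b)) (\<lambda>b. z $ (j, b)) a)"
proof -
  have "(\<Sum>b\<in>UNIV. functional_matrix t c $ (i, a) $ (j, b) * z $ (j, b)) =
      (\<Sum>l\<in>UNIV. base_coeff l i j * dual_mult t (\<lambda>b. c $ (l, b)) (\<lambda>b. z $ (j, b)) a)" for j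
  proof -
    have "functional_matrix t c $ (i, a) $ (j, b) =
        (\<Sum>l\<in>UNIV. base_coeff l i j * (\<Sum>d\<in>UNIV. of_real (c $ (l, d) * bas_prod t b a $ d)))" for b
      unfolding functional_matrix_def sum_component sum_UNIV_prod
      by (simp only: vector_scaleR_component)
         (simp add: Qt_tuple_def sum_distrib_left scaleR_conv_of_real mult_ac)
    then have "(\<Sum>b\<in>UNIV. functional_matrix t c $ (i, a) $ (j, b) * z $ (j, b)) =
       (\<Sum>b\<in>UNIV. \<Sum>l\<in>UNIV. base_coeff l i j * ((\<Sum>d\<in>UNIV. of_real (c $ (l, d) * bas_prod t b a $ d)) * z $ (j, b)))"
      by (simp add: sum_distrib_right mult.assoc)
    also have "\<dots> = (\<Sum>l\<in>UNIV. \<Sum>b\<in>UNIV. base_coeff l i j * ((\<Sum>d\<in>UNIV. of_real (c $ (l, d) * bas_prod t b a $ d)) * z $ (j, b)))"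
      by (rule sum.swap)
    finally show ?thesis
      by (simp add: dual_mult_def sum_distrib_left)
  qed
  then show ?thesis
    unfolding matrix_vector_mult_def vec_lambda_beta sum_UNIV_prod by simp
qed

text \<open>The system is block triangular: rows 3 and 4 involve only components 2 and 1, while
  components 4 and 3 enter rows 1 and 2 only through the fourth equation.\<close>

lemma functional_matrix_rows:
  fixes t c z
  defines "D \<equiv> \<lambda>l j. dual_mult t (\<lambda>b. c $ (l, b)) (\<lambda>b. z $ (j, b))"
  shows "(functional_matrix t c *v z) $ (1, a) = D 1 2 a - \<i> * D 2 2 a + D 4 4 a"
    and "(functional_matrix t c *v z) $ (2, a) = D 1 1 a + \<i> * D 2 1 a + D 3 2 a + D 4 3 a"
    and "(functional_matrix t c *v z) $ (3, a) = D 4 2 a"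
    and "(functional_matrix t c *v z) $ (4, a) = D 4 1 a"
  unfolding functional_matrix_mult_vec D_def sum_4 by (simp_all add: base_coeff_def)


lemma not_singular_functional_Qt:
  assumes "pencil t (c $ (4, Bp)) (c $ (4, Bq)) \<noteq> 0"
  shows "\<not> singular_functional (hermitian_form (Qt_tuple t)) c"
proof
  assume "singular_functional (hermitian_form (Qt_tuple t)) c"
  then obtain z where "z \<noteq> 0" and ker: "functional_matrix t c *v z = 0"
    \<comment> \<open>The test functionals read the four \<open>p\<close>-coordinates.\<close>
    and f: "(\<chi> k. axis (k, Bp) 1) *v z = 0"
    unfolding singular_functional_def form_kernel_hermitian_form[OF hermitian_Qt_tuple]
      functional_matrix_def[symmetric] by blast
  have p0: "z $ (k, Bp) = 0" for k
  proof -
    have "((\<chi> k. axis (k, Bp) 1) *v z) $ k = z $ (k, Bp)"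
      by (simp add: matrix_vector_mult_def axis_def if_distrib[of "\<lambda>x. x * _"] cong: if_cong)
    then show ?thesis by (simp add: f)
  qed
  define d where "d b = c $ (4, b)" for b
  have d: "d Bp \<noteq> 0" "d Bq \<noteq> 0" "d Bp + d Bq \<noteq> 0" "d Bp + t * d Bq \<noteq> 0"
    using assms by (auto simp: pencil_def d_def)
  then have d': "complex_of_real (d Bp) + complex_of_real (d Bq) \<noteq> 0"
      "complex_of_real (d Bp) + complex_of_real t * complex_of_real (d Bq) \<noteq> 0"
    by (metis of_real_add of_real_eq_0_iff, metis of_real_add of_real_mult of_real_eq_0_iff)
  \<comment> \<open>With all four factors nonzero, the annihilator of \<open>d\<close> is a line in
    the span of \<open>p\<close> and \<open>q\<close>, and \<open>d Bq \<noteq> 0\<close> excludes a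
    nonzero vector on it with zero \<open>p\<close>-coordinate.\<close>
  have zero: "z $ (j, b) = 0" if "\<And>a. dual_mult t d (\<lambda>b. z $ (j, b)) a = 0" for j b
    using that[of Bp] that[of Bq] that[of E1] that[of E2] that[of E3] that[of E4] that[of B1] p0[of j] d d'
    by (cases b) (simp_all add: dual_mult_simps)
  note rows = functional_matrix_rows[of t c z, unfolded ker, folded d_def[abs_def], simplified]
  have z2: "z $ (2, b) = 0" for b
    by (rule zero) (use rows(3) in simp)
  have z1: "z $ (1, b) = 0" for b
    by (rule zero) (use rows(4) in simp)
  have z4: "z $ (4, b) = 0" for b
    by (rule zero) (use rows(1) in \<open>simp add: z1 z2 dual_mult_0\<close>)
  have z3: "z $ (3, b) = 0" for b
    by (rule zero) (use rows(2) in \<open>simp add: z1 z2 dual_mult_0\<close>)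
  have "z $ (j, b) = 0" for j b
    using exhaust_4[of j] z1 z2 z3 z4 by auto
  then have "z = 0" by (auto simp: vec_eq_iff)
  with \<open>z \<noteq> 0\<close> show False ..
qed

text \<open>This takes the place of a dimension count: a square system with one empty equation has a
  nontrivial solution.\<close>

lemma zero_row_kernel:
  fixes A :: "'a::field^'n^'n"
  assumes "A $ i = 0"
  shows "\<exists>x. x \<noteq> 0 \<and> A *v x = 0"
proof -
  have "det A = 0"
    by (rule det_zero_row(2)[of i]) (simp add: row_def assms vec_eq_iff)
  then have "\<not> invertible A"
    by (simp add: invertible_det_nz)
  then show ?thesis
    using matrix_left_invertible_ker[of A] invertible_left_inverse[of A] by blast
qed

text \<open>The kernel vectors are sought in the span of \<open>8\<close> coordinates, where only three of the kernel
  equations are not automatic. Together with the four functionals \<open>f\<close> this leaves one row of a square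
  system free.\<close>

lemma singular_functional_Qt:
  assumes "pencil t (c $ (4, Bp)) (c $ (4, Bq)) = 0"
  shows "singular_functional (hermitian_form (Qt_tuple t)) c"
  unfolding singular_functional_def
proof
  fix f :: "complex^(4 \<times> bas)^4"
  define d where "d b = c $ (4, b)" for b
  have d: "d Bp = 0 \<or> d Bp + d Bq = 0 \<or> d Bp + t * d Bq = 0 \<or> d Bq = 0"
    using assms by (auto simp: pencil_def d_def)
  \<comment> \<open>\<open>e\<close> is the generator whose square is annihilated by
    \<open>d\<close>, according to the vanishing factor.\<close>
  have "\<exists>e. e \<in> {E1, E2, E3, E4} \<and> (\<forall>x. (\<forall>b. b \<notin> {e, Bp, Bq} \<longrightarrow> x b = 0) \<longrightarrow>
      (\<forall>a. a \<noteq> B1 \<longrightarrow> dual_mult t d x a = 0))"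
  proof -
    have *: "dual_mult t d x a = 0" if "a \<noteq> B1" "x B1 = 0" 
      "d Bp * x E1 = 0" "(d Bp + d Bq) * x E2 = 0" "(d Bp + t * d Bq) * x E3 = 0" "d Bq * x E4 = 0"
      for x :: "bas \<Rightarrow> complex" and a
    proof -
      have "complex_of_real (d Bp) * x E1 = 0" "(complex_of_real (d Bp) + d Bq) * x E2 = 0" 
        "(complex_of_real (d Bp) + complex_of_real t * d Bq) * x E3 = 0" "complex_of_real (d Bq) * x E4 = 0"
        using that(3-) by (simp_all only: of_real_add of_real_mult)
      then show ?thesis
        using that(1,2) by (cases a) (simp_all only: dual_mult_simps, simp_all)
    qed
    from d show ?thesis
    proof (elim disjE)
      assume "d Bp = 0"
      then show ?thesis by (intro exI[of _ E1]) (auto intro!: *)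
    next
      assume "d Bp + d Bq = 0"
      then show ?thesis by (intro exI[of _ E2]) (auto intro!: * simp flip: of_real_add)
    next
      assume "d Bp + t * d Bq = 0"
      then show ?thesis by (intro exI[of _ E3]) (auto intro!: * simp flip: of_real_add of_real_mult)
    next
      assume "d Bq = 0"
      then show ?thesis by (intro exI[of _ E4]) (auto intro!: *)
    qed
  qed
  then obtain e where e: "e \<in> {E1, E2, E3, E4}"
    and dual0: "\<And>x a. (\<And>b. b \<notin> {e, Bp, Bq} \<Longrightarrow> x b = 0) \<Longrightarrow> a \<noteq> B1 \<Longrightarrow> dual_mult t d x a = 0"
    by blast
  define J :: "(4 \<times> bas) set" where "J = {(1, Bp), (1, Bq), (3, e), (3, Bp), (3, Bq), (4, e), (4, Bp), (4, Bq)}"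
  define M where "M = functional_matrix t c"
  \<comment> \<open>Rows outside \<open>J\<close> force coordinates to vanish; those in
    \<open>J\<close> hold the zero row, the four rows of \<open>f\<close> and the three remaining
    kernel equations.\<close>
  define A :: "complex^(4 \<times> bas)^(4 \<times> bas)" where
    "A = (\<chi> x. if x \<notin> J then axis x 1 else if x = (1, Bp) then 0 else if x = (1, Bq) then f $ 1
       else if x = (3, e) then f $ 2 else if x = (3, Bp) then f $ 3 else if x = (3, Bq) then f $ 4
       else if x = (4, e) then M $ (4, B1) else if x = (4, Bp) then M $ (1, B1) else M $ (2, B1))"
  have "A $ (1, Bp) = 0"
    by (simp add: A_def J_def)
  then obtain z where "z \<noteq> 0" and Az: "A *v z = 0"
    using zero_row_kernel by blast
  have row: "(\<Sum>y\<in>UNIV. A $ x $ y * z $ y) = 0" for x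
    using arg_cong[OF Az, of "\<lambda>v. v $ x"] by (simp add: matrix_vector_mult_def)
  have z0: "z $ x = 0" if "x \<notin> J" for x
    using row[of x] that
    by (simp add: A_def axis_def if_distrib[of "\<lambda>x. x * _"] cong: if_cong)
  have "(f *v z) $ k = 0" for k
    using e row[of "(1, Bq)"] row[of "(3, e)"] row[of "(3, Bp)"] row[of "(3, Bq)"] exhaust_4[of k]
    by (auto simp: A_def J_def matrix_vector_mult_def)
  then have f: "f *v z = 0"
    by (simp add: vec_eq_iff)
  have M1: "(M *v z) $ (4, B1) = 0" "(M *v z) $ (1, B1) = 0" "(M *v z) $ (2, B1) = 0"
    using e row[of "(4, e)"] row[of "(4, Bp)"] row[of "(4, Bq)"]
    by (auto simp: A_def J_def matrix_vector_mult_def)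
  note rows = functional_matrix_rows[of t c z, folded d_def[abs_def] M_def]
  have z2: "(\<lambda>b. z $ (2, b)) = (\<lambda>_. 0)"
    by (auto intro!: z0 simp: J_def)
  have dz: "dual_mult t d (\<lambda>b. z $ (j, b)) a = 0" if "a \<noteq> B1" "j \<in> {1, 3, 4}" for a j
    using that by (intro dual0) (auto intro!: z0 simp: J_def)
  \<comment> \<open>Component 1 also meets the functionals of equations 1 and 2, which are
    arbitrary; this is why \<open>J\<close> leaves it only its \<open>p\<close>- and
    \<open>q\<close>-coordinates.\<close>
  have z1: "dual_mult t d' (\<lambda>b. z $ (1, b)) a = 0" if "a \<noteq> B1" for d' a
  proof -
    have "z $ (1, b) = 0" if "b \<notin> {Bp, Bq}" for b
      using that e by (intro z0) (auto simp: J_def)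
    then show ?thesis
      using that by (cases a) (simp_all add: dual_mult_simps)
  qed
  have "(M *v z) $ (i, a) = 0" for i a
  proof (cases "a = B1")
    case True
    then show ?thesis
      using M1 exhaust_4[of i] by (auto simp: rows(3) z2 dual_mult_0)
  next
    case False
    then show ?thesis
      using exhaust_4[of i] by (auto simp: rows z1 z2 dz dual_mult_0)
  qed
  then have "M *v z = 0"
    by (auto simp: vec_eq_iff)
  then show "\<exists>z. z \<noteq> 0 \<and> z \<in> form_kernel (hermitian_form (Qt_tuple t)) c \<and> f *v z = 0"
    using f \<open>z \<noteq> 0\<close>
    unfolding form_kernel_hermitian_form[OF hermitian_Qt_tuple] M_def functional_matrix_def by blast
qed

lemma singular_functional_Qt_iff:
  "singular_functional (hermitian_form (Qt_tuple t)) c \<longleftrightarrow> pencil t (c $ (4, Bp)) (c $ (4, Bq)) = 0"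
  using singular_functional_Qt not_singular_functional_Qt by blast

lemma quadric_orbit_Qt_inject:
  assumes "1 < s" "s < 2" "1 < t" "t < 2" and eq: "quadric_orbit (Qt s) = quadric_orbit (Qt t)"
  shows "s = t"
proof -
  let ?\<phi> = "\<lambda>t. hermitian_form (Qt_tuple t)"
  have inv: "matrix_inv (mat 1 :: real^(4 \<times> bas)^(4 \<times> bas)) = mat 1"
    unfolding matrix_inv_def by (rule some_equality) simp_all
  have "transform_form (mat 1) (mat 1) (?\<phi> s) = ?\<phi> s"
    by (simp add: transform_form_def inv)
  then have "Qt s = quadric_of_form (transform_form (mat 1) (mat 1) (?\<phi> s))"
    by (simp add: Qt_eq_cr_quadric cr_quadric_def)
  moreover have "invertible (mat 1 :: real^(4 \<times> bas)^(4 \<times> bas))"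
    unfolding invertible_def by (rule exI[of _ "mat 1"]) simp
  moreover have "det (mat 1 :: complex^(4 \<times> bas)^(4 \<times> bas)) = 1"
    by simp
  ultimately have "Qt s \<in> quadric_orbit (Qt s)"
    unfolding quadric_orbit_def using hermitian_Qt_tuple Qt_eq_cr_quadric[of s] by blast
  then obtain C \<rho> H where C: "det C = 1"
    and Qs: "Qt s = quadric_of_form (transform_form C \<rho> (hermitian_form H))"
    and Qt: "Qt t = cr_quadric H"
    unfolding eq unfolding quadric_orbit_def by blast
  \<comment> \<open>The orbit admits any tuple presenting \<open>Qt t\<close>, but the quadric
    determines the form.\<close>
  have "hermitian_form H = ?\<phi> t"
    using Qt by (intro quadric_of_form_inject) (simp add: Qt_eq_cr_quadric cr_quadric_def)
  then have \<phi>: "?\<phi> s = transform_form C \<rho> (?\<phi> t)"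
    using Qs by (intro quadric_of_form_inject) (simp add: Qt_eq_cr_quadric cr_quadric_def)
  have "invertible C"
    using C by (simp add: invertible_det_nz)
  define R where "R = matrix_inv \<rho>"
  have sing: "singular_functional (?\<phi> s) c \<longleftrightarrow> singular_functional (?\<phi> t) (c v* R)" for c
    unfolding \<phi> R_def using \<open>invertible C\<close> by (rule singular_functional_transform_form)
  show ?thesis
  proof (rule pencil_rigid)
    fix x y :: real
    \<comment> \<open>On this plane of functionals the two coordinates of \<open>c v* R\<close> seen
      by \<open>pencil t\<close> are a linear substitution in \<open>x\<close> and
      \<open>y\<close>.\<close>
    define c :: "real^(4 \<times> bas)" where "c = x *\<^sub>R axis (4, Bp) 1 + y *\<^sub>R axis (4, Bq) 1"
    have "c v* R = x *\<^sub>R (axis (4, Bp) 1 v* R) + y *\<^sub>R (axis (4, Bq) 1 v* R)"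
      unfolding c_def vector_matrix_left_distrib scaleR_vector_matrix_assoc ..
    moreover have "(axis k 1 v* R) $ l = R $ k $ l" for k l
      by (simp add: vector_matrix_mult_def axis_def if_distrib[of "\<lambda>x. x * _"] cong: if_cong)
    ultimately have "(c v* R) $ l = R $ (4, Bp) $ l * x + R $ (4, Bq) $ l * y" for l
      by simp
    moreover have "c $ (4, Bp) = x" "c $ (4, Bq) = y"
      by (simp_all add: c_def axis_def)
    ultimately show "pencil s x y = 0 \<longleftrightarrow>
        pencil t (R $ (4, Bp) $ (4, Bp) * x + R $ (4, Bq) $ (4, Bp) * y)
          (R $ (4, Bp) $ (4, Bq) * x + R $ (4, Bq) $ (4, Bq) * y) = 0"
      using sing[of c] by (simp add: singular_functional_Qt_iff)
  qed (use assms in auto)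
qed

theorem theorem5:
  shows "(\<forall>t. 1 < t \<and> t < 2 \<longrightarrow>
            cr_quadric_of_type 28 28 (Qt t) \<and> nondegenerate_quadric (Qt t) \<and>
            exceptional_quadric (Qt t)) \<and>
         (\<forall>s t. 1 < s \<and> s < 2 \<and> 1 < t \<and> t < 2 \<and> s \<noteq> t \<longrightarrow>
            quadric_orbit (Qt s) \<noteq> quadric_orbit (Qt t)) \<and>
         continuous_modulus exceptional_orbits {1<..<2} Qt"
proof -
  have "cr_quadric_of_type 28 28 (Qt t)" for t
    unfolding cr_quadric_of_type_def
    using hermitian_Qt_tuple Qt_eq_cr_quadric by (auto simp: CARD_bas)
  moreover have "nondegenerate_quadric (Qt t)" for t
    unfolding nondegenerate_quadric_def
    using hermitian_Qt_tuple Qt_eq_cr_quadric nondegenerate_Qt_tuple by blast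
  moreover have inj: "s = t"
    if "1 < s" "s < 2" "1 < t" "t < 2" "quadric_orbit (Qt s) = quadric_orbit (Qt t)" for s t
    using that by (rule quadric_orbit_Qt_inject)
  moreover have "continuous_modulus exceptional_orbits {1<..<2} Qt"
    unfolding continuous_modulus_def
  proof (intro conjI)
    show "\<exists>a b. a < b \<and> {1<..<2} = {a<..<b :: real}"
      by (intro exI[of _ 1] exI[of _ 2]) simp
    show "\<exists>H. continuous_on {1<..<2} H \<and>
        (\<forall>t\<in>{1<..<2}. hermitian_tuple (H t) \<and> Qt t = cr_quadric (H t))"
      using continuous_Qt_tuple hermitian_Qt_tuple Qt_eq_cr_quadric by blast
    show "\<forall>t\<in>{1<..<2}. quadric_orbit (Qt t) \<in> exceptional_orbits"
      unfolding exceptional_orbits_def using exceptional_Qt by blast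
    show "inj_on (\<lambda>t. quadric_orbit (Qt t)) {1<..<2}"
      by (rule inj_onI) (use inj in auto)
  qed
  ultimately show ?thesis
    using exceptional_Qt by blast
qed

end
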